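(* There exists a determinantal vector $m\in\mathbb{Z}^r$ such that the Weyman complex of $m$ is reduced to only one non-zero cohomology group on each of $K_0(m)$ and $K_1(m)$ (that is, for each $\nu\in\{0,1\}$ there is exactly one $p\in\{0,\dots,n+1\}$ with $H^{p-\nu}(X,m-pd)\ne0$) if and only if all defects vanish, i.e. $\delta_k=0$ for all $k=1,\dots,r$.
   Context: Let $r\ge 1$ and let $l=(l_1,\dots,l_r)$, $d=(d_1,\dots,d_r)$ be vectors of positive integers; put $n=\sum_{k=1}^r l_k$. Let $X=\mathbb{P}^{l_1}\times\cdots\times\mathbb{P}^{l_r}$ over an algebraically closed field of characteristic zero. For $a\in\mathbb{Z}^r$, $H^q(X,a)$ denotes the $q$-th cohomology of the sheaf $\mathcal{O}_X(a_1,\dots,a_r)$. By the Künneth and Bott formulae, $H^q(X,a)=\bigoplus\bigotimes_{k}H^{j_k}(\mathbb{P}^{l_k},a_k)$ (sum over $j_k\in\{0,l_k\}$ with $\sum_k j_k=q$), where $H^0(\mathbb{P}^{l_k},a_k)\ne0\iff a_k\ge0$ and $H^{l_k}(\mathbb{P}^{l_k},a_k)\neq0\iff a_k<-l_k$. For a degree vector $m\in\mathbb{Z}^r$ and $\nu\in\mathbb{Z}$, the $\nu$-th term of the Weyman complex is $K_\nu(m)=\bigoplus_{p=0}^{n+1}H^{p-\nu}(X,m-pd)^{\binom{n+1}{p}}$. The vector $m$ is called determinantal if the complex has just the two terms $K_1(m)\to K_0(m)$, i.e. $K_\nu(m)=0$ for all $\nu\notin\{0,1\}$; by a result of Weyman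 and Zelevinsky this is equivalent to $K_{-1}(m)=K_2(m)=0$. The defect vector $\delta\in\mathbb{Z}^r$ is $\delta_k=l_k-\lceil l_k/d_k\rceil$. *)

theory Defs
  imports Complex_Main "HOL-Library.Poly_Mapping" "HOL-Algebra.Product_Groups"
    "HOL-Computational_Algebra.Polynomial"
begin

text \<open>
  The factors of X, a product of projective spaces of dimensions \<open>l k\<close>, are indexed by a finite type \<open>'r\<close> (so \<open>r = CARD('r) \<ge> 1\<close> is
  arbitrary). The homogeneous coordinates are \<open>x k i\<close> with \<open>0 \<le> i \<le> l k\<close>, and a Laurent polynomial
  over the ground field \<open>'k\<close> is a finitely supported function from exponents \<open>e\<close> (where \<open>e k i\<close> is
  the exponent of \<open>x k i\<close>) to coefficients.
\<close>

type_synonym ('r, 'k) laurent = "('r \<Rightarrow> nat \<Rightarrow> int) \<Rightarrow>\<^sub>0 'k"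

type_synonym ('r, 'k) cochain = "('r \<Rightarrow> nat) list \<Rightarrow> ('r, 'k) laurent"

text \<open>
  The standard affine cover of \<open>X\<close> consists of the sets \<open>U\<^sub>v\<close> on which all the coordinates
  \<open>x k (v k)\<close> are nonzero.
\<close>

definition cover_index :: "('r \<Rightarrow> nat) \<Rightarrow> ('r \<Rightarrow> nat) set" where
  "cover_index l = {v. \<forall>k. v k \<le> l k}"

text \<open>
  Sections of \<open>\<O>(a)\<close> over the intersection of the \<open>U\<^sub>v\<close>, \<open>v \<in> V\<close>: the multidegree \<open>a\<close> part of the
  Cox ring localized at the coordinates \<open>x k (v k)\<close>. Restriction maps are inclusions.
\<close>

definition sections :: "('r \<Rightarrow> nat) \<Rightarrow> ('r \<Rightarrow> int) \<Rightarrow> ('r \<Rightarrow> nat) set \<Rightarrow> ('r, 'k::field) laurent set" where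
  "sections l a V = {f. \<forall>e \<in> Poly_Mapping.keys f. \<forall>k.
     (\<forall>i > l k. e k i = 0) \<and>
     (\<Sum>i\<le>l k. e k i) = a k \<and>
     (\<forall>i \<le> l k. e k i < 0 \<longrightarrow> (\<exists>v\<in>V. v k = i))}"

text \<open>
  The full (not necessarily alternating) Cech complex: a \<open>q\<close>-cochain assigns to each \<open>(q+1)\<close>-tuple
  of indices of the cover a section over the corresponding intersection, and is \<open>0\<close> on every other
  list. For \<open>q < 0\<close> only the zero cochain remains.
\<close>

definition cochains :: "('r \<Rightarrow> nat) \<Rightarrow> ('r \<Rightarrow> int) \<Rightarrow> int \<Rightarrow> ('r, 'k::field) cochain set" where
  "cochains l a q = {c. \<forall>s. c s \<in> sections l a (set s) \<and>
     (c s \<noteq> 0 \<longrightarrow> s \<noteq> [] \<and> int (length s) = q + 1 \<and> set s \<subseteq> cover_index l)}"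

definition coboundary :: "('r \<Rightarrow> nat) \<Rightarrow> ('r, 'k::field) cochain \<Rightarrow> ('r, 'k) cochain" where
  "coboundary l c = (\<lambda>s. if set s \<subseteq> cover_index l
     then \<Sum>j<length s. (if even j then c (take j s @ drop (Suc j) s)
                                  else - c (take j s @ drop (Suc j) s))
     else 0)"

definition cocycles :: "('r \<Rightarrow> nat) \<Rightarrow> ('r \<Rightarrow> int) \<Rightarrow> int \<Rightarrow> ('r, 'k::field) cochain set" where
  "cocycles l a q = {c \<in> cochains l a q. coboundary l c = (\<lambda>_. 0)}"

definition cocycle_group :: "('r \<Rightarrow> nat) \<Rightarrow> ('r \<Rightarrow> int) \<Rightarrow> int \<Rightarrow> ('r, 'k::field) cochain monoid" where
  "cocycle_group l a q = \<lparr>carrier = cocycles l a q, monoid.mult = (\<lambda>b c s. b s + c s), one = (\<lambda>_. 0)\<rparr>"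

text \<open>
  \<open>H\<^sup>q(X, a)\<close>, the Cech cohomology of \<open>\<O>(a)\<close> for the standard affine cover, over the field \<open>'k\<close>, as the additive group underlying the vector space;
  only its vanishing matters below.
\<close>

definition cohomology ::
  "'k::field itself \<Rightarrow> ('r \<Rightarrow> nat) \<Rightarrow> int \<Rightarrow> ('r \<Rightarrow> int) \<Rightarrow> ('r, 'k) cochain set monoid" where
  "cohomology _ l q a = cocycle_group l a q Mod (coboundary l ` cochains l a (q - 1))"

definition total_dim :: "('r::finite \<Rightarrow> nat) \<Rightarrow> nat" where
  "total_dim l = (\<Sum>k\<in>UNIV. l k)"

definition twist :: "('r \<Rightarrow> int) \<Rightarrow> nat \<Rightarrow> ('r \<Rightarrow> nat) \<Rightarrow> 'r \<Rightarrow> int" where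
  "twist m p d = (\<lambda>k. m k - int p * int (d k))"

text \<open>
  \<open>K\<^sub>\<nu>(m)\<close>; the second component of the index \<open>(p, i)\<close> enumerates the \<open>(n+1 choose p)\<close> copies of
  \<open>H\<^sup>p\<^sup>-\<^sup>\<nu>(X, m - p d)\<close>. The index set is finite, so the product is the direct sum.
\<close>

definition weyman_term ::
  "'k::field itself \<Rightarrow> ('r::finite \<Rightarrow> nat) \<Rightarrow> ('r \<Rightarrow> nat) \<Rightarrow> ('r \<Rightarrow> int) \<Rightarrow> int
     \<Rightarrow> (nat \<times> nat \<Rightarrow> ('r, 'k) cochain set) monoid" where
  "weyman_term K l d m \<nu> =
     product_group (SIGMA p : {0..total_dim l + 1}. {..<(total_dim l + 1) choose p})
       (\<lambda>(p, i). cohomology K l (int p - \<nu>) (twist m p d))"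

definition determinantal ::
  "'k::field itself \<Rightarrow> ('r::finite \<Rightarrow> nat) \<Rightarrow> ('r \<Rightarrow> nat) \<Rightarrow> ('r \<Rightarrow> int) \<Rightarrow> bool" where
  "determinantal K l d m \<longleftrightarrow> (\<forall>\<nu>. \<nu> \<notin> {0, 1} \<longrightarrow> trivial_group (weyman_term K l d m \<nu>))"

definition defect :: "('r \<Rightarrow> nat) \<Rightarrow> ('r \<Rightarrow> nat) \<Rightarrow> 'r \<Rightarrow> int" where
  "defect l d k = int (l k) - \<lceil>real (l k) / real (d k)\<rceil>"

text \<open>
  The quotient defining \<open>cohomology\<close> is a group (\<open>coboundary\<close> squares to zero), so that
  \<open>\<not> trivial_group\<close> does express nonvanishing.
\<close>

lemma coboundary_add:
  "coboundary l (\<lambda>s. b s + c s) = (\<lambda>s. coboundary l b s + coboundary l c s)"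
  by (rule ext) (auto simp: coboundary_def sum.distrib [symmetric] intro!: sum.cong)

lemma coboundary_uminus: "coboundary l (\<lambda>s. - c s) = (\<lambda>s. - coboundary l c s)"
  by (rule ext) (auto simp: coboundary_def sum_negf [symmetric] intro!: sum.cong)

lemma coboundary_zero: "coboundary l (\<lambda>_. 0) = (\<lambda>_. 0)"
  by (rule ext) (auto simp: coboundary_def intro!: sum.neutral)

lemma sections_zero: "0 \<in> sections l a V"
  by (simp add: sections_def)

lemma sections_add: "f \<in> sections l a V \<Longrightarrow> g \<in> sections l a V \<Longrightarrow> f + g \<in> sections l a V"
  using Poly_Mapping.keys_add [of f g] unfolding sections_def by blast

lemma sections_uminus: "f \<in> sections l a V \<Longrightarrow> - f \<in> sections l a V"
  by (simp add: sections_def)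

lemma sections_mono: "V \<subseteq> W \<Longrightarrow> sections l a V \<subseteq> sections l a W"
  unfolding sections_def by blast

lemma sections_sum: "(\<And>j. j \<in> A \<Longrightarrow> f j \<in> sections l a V) \<Longrightarrow> sum f A \<in> sections l a V"
  by (induction A rule: infinite_finite_induct) (auto simp: sections_zero intro: sections_add)

lemma cochains_zero: "(\<lambda>_. 0) \<in> cochains l a q"
  by (simp add: cochains_def sections_zero)

lemma cochains_add:
  assumes "b \<in> cochains l a q" "c \<in> cochains l a q"
  shows "(\<lambda>s. b s + c s) \<in> cochains l a q"
proof -
  have "b s \<noteq> 0 \<or> c s \<noteq> 0" if "b s + c s \<noteq> 0" for s
    using that by auto
  then show ?thesis
    using assms unfolding cochains_def by (blast intro: sections_add)
qed

lemma cochains_uminus: "c \<in> cochains l a q \<Longrightarrow> (\<lambda>s. - c s) \<in> cochains l a q"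
  by (simp add: cochains_def sections_uminus)

lemma coboundary_cochains:
  assumes c: "c \<in> cochains l a q"
  shows "coboundary l c \<in> cochains l a (q + 1)"
proof -
  have "coboundary l c s \<in> sections l a (set s)" for s
  proof -
    have "c (take j s @ drop (Suc j) s) \<in> sections l a (set s)" for j
    proof -
      have "set (take j s @ drop (Suc j) s) \<subseteq> set s"
        using set_take_subset[of j s] set_drop_subset[of "Suc j" s] by simp
      then show ?thesis using c sections_mono unfolding cochains_def by blast
    qed
    then show ?thesis
      by (auto simp: coboundary_def sections_zero intro!: sections_sum sections_uminus)
  qed
  moreover have "s \<noteq> [] \<and> int (length s) = (q + 1) + 1 \<and> set s \<subseteq> cover_index l"
    if nz: "coboundary l c s \<noteq> 0" for s
  proof -
    have sub: "set s \<subseteq> cover_index l" and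
      "(\<Sum>j<length s. if even j then c (take j s @ drop (Suc j) s)
                                  else - c (take j s @ drop (Suc j) s)) \<noteq> 0"
      using nz by (auto simp: coboundary_def split: if_splits)
    then obtain j where j: "j < length s" "c (take j s @ drop (Suc j) s) \<noteq> 0"
      by (elim sum.not_neutral_contains_not_neutral) (auto split: if_splits)
    then have "int (length (take j s @ drop (Suc j) s)) = q + 1"
      using c unfolding cochains_def by blast
    with j sub show ?thesis by auto
  qed
  ultimately show ?thesis by (simp add: cochains_def)
qed

lemma remove_nth_swap:
  assumes "i < j" "j < length s"
  shows "take i (take j s @ drop (Suc j) s) @ drop (Suc i) (take j s @ drop (Suc j) s)
       = take (j - 1) (take i s @ drop (Suc i) s) @ drop (Suc (j - 1)) (take i s @ drop (Suc i) s)"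
  using assms by (intro nth_equalityI)
    (auto simp: nth_append min_def, (intro arg_cong[where f = "nth s"]; linarith)?)

lemma coboundary_coboundary: "coboundary l (coboundary l c) = (\<lambda>_. 0)"
proof
  fix s :: "('a \<Rightarrow> nat) list"
  define R where "R = (\<lambda>j (s :: ('a \<Rightarrow> nat) list). take j s @ drop (Suc j) s)"
  define \<epsilon> where "\<epsilon> = (\<lambda>(j::nat) (x :: ('a, 'b) laurent). if even j then x else - x)"
  have cb: "coboundary l b t =
      (if set t \<subseteq> cover_index l then \<Sum>j<length t. \<epsilon> j (b (R j t)) else 0)" for b t
    by (simp add: coboundary_def R_def \<epsilon>_def cong: if_cong)
  have R_set: "set (R j s) \<subseteq> set s" for j
    using set_take_subset[of j s] set_drop_subset[of "Suc j" s] by (simp add: R_def)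
  have \<epsilon>_sum: "\<epsilon> j (sum f A) = (\<Sum>i\<in>A. \<epsilon> j (f i))" for j A and f :: "nat \<Rightarrow> _"
    by (simp add: \<epsilon>_def sum_negf)
  show "coboundary l (coboundary l c) s = 0"
  proof (cases "set s \<subseteq> cover_index l")
    case False
    then show ?thesis by (simp add: cb)
  next
    case True
    define N where "N = length s"
    define g where "g = (\<lambda>(j, i). \<epsilon> j (\<epsilon> i (c (R i (R j s)))))"
    have len: "length (R j s) = N - 1" if "j < N" for j
      using that by (auto simp: R_def N_def)
    have "coboundary l (coboundary l c) s = (\<Sum>j<N. \<epsilon> j (coboundary l c (R j s)))"
      using True by (simp add: cb[of "coboundary l c"] N_def)
    also have "\<dots> = (\<Sum>j<N. \<Sum>i<N - 1. g (j, i))"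
    proof (rule sum.cong)
      fix j assume "j \<in> {..<N}"
      moreover have "set (R j s) \<subseteq> cover_index l"
        using R_set True by (rule order_trans)
      ultimately show "\<epsilon> j (coboundary l c (R j s)) = (\<Sum>i<N - 1. g (j, i))"
        by (simp add: cb[of c] len \<epsilon>_sum g_def)
    qed simp
    also have "\<dots> = sum g ({..<N} \<times> {..<N - 1})"
      by (simp add: sum.cartesian_product)
    also have "\<dots> = sum g {(j, i). i < j \<and> j < N} + sum g {(j, i). j \<le> i \<and> i < N - 1}"
    proof -
      have eq: "{..<N} \<times> {..<N - 1} = {(j, i). i < j \<and> j < N} \<union> {(j, i). j \<le> i \<and> i < N - 1}"
        by auto
      have "finite {(j, i). i < j \<and> j < N}" "finite {(j, i). j \<le> i \<and> i < N - 1}"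
        by (rule finite_subset[of _ "{..<N} \<times> {..<N}"]; auto)+
      then show ?thesis unfolding eq by (intro sum.union_disjoint) auto
    qed
    also have "sum g {(j, i). i < j \<and> j < N} = (\<Sum>x\<in>{(j, i). j \<le> i \<and> i < N - 1}. - g x)"
    proof (rule sum.reindex_bij_witness[where i = "\<lambda>(j, i). (Suc i, j)" and j = "\<lambda>(j, i). (i, j - 1)"])
      fix x assume "x \<in> {(j, i). i < j \<and> j < N}"
      then obtain i j where x: "x = (j, i)" "i < j" "j < N" by auto
      have "R i (R j s) = R (j - 1) (R i s)"
        using remove_nth_swap[of i j s] x unfolding R_def N_def by simp
      then show "- g (case x of (j, i) \<Rightarrow> (i, j - 1)) = g x"
        using x by (cases j) (auto simp: g_def \<epsilon>_def)
    qed auto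
    finally show ?thesis by (simp add: sum_negf)
  qed
qed

lemma comm_group_cocycle_group:
  "comm_group (cocycle_group l a q :: ('r, 'k::field) cochain monoid)"
proof (rule comm_groupI)
  fix x :: "('r, 'k) cochain"
  assume x: "x \<in> carrier (cocycle_group l a q)"
  show "\<exists>y\<in>carrier (cocycle_group l a q). y \<otimes>\<^bsub>cocycle_group l a q\<^esub> x = \<one>\<^bsub>cocycle_group l a q\<^esub>"
    using x by (intro bexI[of _ "\<lambda>s. - x s"])
      (auto simp: cocycle_group_def cocycles_def cochains_uminus coboundary_uminus)
qed (auto simp: cocycle_group_def cocycles_def cochains_add cochains_zero coboundary_add
       coboundary_zero add.assoc add.commute)

lemma group_cohomology: "group (cohomology K l q a)"
proof -
  interpret G: comm_group "cocycle_group l a q :: ('a, 'b) cochain monoid"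
    by (rule comm_group_cocycle_group)
  have inv: "inv\<^bsub>cocycle_group l a q\<^esub> b = (\<lambda>s. - b s)" if "b \<in> cocycles l a q"
    for b :: "('a, 'b) cochain"
    using that by (intro G.inv_equality)
      (auto simp: cocycle_group_def cocycles_def cochains_uminus coboundary_uminus)
  have "subgroup (coboundary l ` cochains l a (q - 1))
          (cocycle_group l a q :: ('a, 'b) cochain monoid)"
  proof (rule G.subgroupI)
    show sub: "coboundary l ` cochains l a (q - 1)
        \<subseteq> carrier (cocycle_group l a q :: ('a, 'b) cochain monoid)"
      using coboundary_cochains[where q = "q - 1"]
      by (auto simp: cocycle_group_def cocycles_def coboundary_coboundary)
    show "coboundary l ` cochains l a (q - 1) \<noteq> ({} :: ('a, 'b) cochain set)"
      using cochains_zero by blast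
    show "inv\<^bsub>cocycle_group l a q\<^esub> b \<in> coboundary l ` cochains l a (q - 1)"
      if b: "b \<in> coboundary l ` cochains l a (q - 1)" for b :: "('a, 'b) cochain"
    proof -
      have "b \<in> cocycles l a q"
        using sub b by (auto simp: cocycle_group_def)
      moreover from b obtain c where "c \<in> cochains l a (q - 1)" "b = coboundary l c"
        by blast
      ultimately show ?thesis
        using inv[of b] by (auto simp: coboundary_uminus [symmetric] intro: cochains_uminus)
    qed
    show "b \<otimes>\<^bsub>cocycle_group l a q\<^esub> c \<in> coboundary l ` cochains l a (q - 1)"
      if "b \<in> coboundary l ` cochains l a (q - 1)" "c \<in> coboundary l ` cochains l a (q - 1)"
      for b c :: "('a, 'b) cochain"
      using that by (auto simp: cocycle_group_def coboundary_add [symmetric] intro: cochains_add)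
  qed
  then have "coboundary l ` cochains l a (q - 1) \<lhd>
      (cocycle_group l a q :: ('a, 'b) cochain monoid)"
    by (rule G.subgroup_imp_normal)
  then show ?thesis
    unfolding cohomology_def by (rule normal.factorgroup_is_group)
qed

end

theory Submission
  imports Defs
begin

text \<open>
  The Cech complex splits over the exponents \<open>e\<close> of Laurent monomials. The part of exponent \<open>e\<close> consists
  of the scalar cochains supported on those tuples of cover indices which hit every coordinate with
  negative exponent. Removing one such coordinate at a time relates the complexes for smaller boxes of
  cover indices by short exact sequences, and shows that the part is exact unless in each factor of \<open>X\<close>
  either no or every coordinate has negative exponent; in that case there is cohomology exactly in
  the degree which is the total dimension of the factors of the second kind. This yields the
  Kuenneth and Bott formulae.

  For the numerical part, the \<open>k\<close>-th factor kills the terms with \<open>m\<^sub>k < p d\<^sub>k \<le> m\<^sub>k + l\<^sub>k\<close>, that is, at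
  most \<open>\<lceil>l\<^sub>k / d\<^sub>k\<rceil> = l\<^sub>k - \<delta>\<^sub>k\<close> values of \<open>p\<close>. If all but two of the \<open>n + 2\<close> values of \<open>p\<close> are killed, then
  \<open>n \<le> n - \<Sum> \<delta>\<^sub>k\<close>, so the defects vanish. Conversely, if \<open>P\<^sub>k\<close> are the partial sums of the \<open>l\<^sub>k\<close>, the
  vector \<open>m\<^sub>k = P\<^sub>k d\<^sub>k - l\<^sub>k\<close> makes the \<open>k\<close>-th factor kill the block \<open>P\<^sub>k - l\<^sub>k < p \<le> P\<^sub>k\<close>, so only \<open>p = 0\<close>
  and \<open>p = n + 1\<close> survive.
\<close>

section \<open>Relative simplicial cochains\<close>

text \<open>
  The alternating sum over faces, in recursive form: the square of the coboundary and the cone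
  homotopy then come out by unfolding one step.
\<close>

fun face_sum :: "('v list \<Rightarrow> 'b::ab_group_add) \<Rightarrow> 'v list \<Rightarrow> 'b" where
  "face_sum c [] = 0"
| "face_sum c (x # s) = c s - face_sum (\<lambda>t. c (x # t)) s"

lemma face_sum_cong:
  "(\<And>t. set t \<subseteq> set s \<Longrightarrow> b t = c t) \<Longrightarrow> face_sum b s = face_sum c s"
proof (induction s arbitrary: b c)
  case (Cons x s)
  have "b s = c s" by (rule Cons.prems) auto
  moreover have "face_sum (\<lambda>t. b (x # t)) s = face_sum (\<lambda>t. c (x # t)) s"
    by (rule Cons.IH) (rule Cons.prems, auto)
  ultimately show ?case by simp
qed simp

lemma face_sum_diff: "face_sum (\<lambda>s. b s - c s) s = face_sum b s - face_sum c s"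
  by (induction s arbitrary: b c) auto

lemma face_sum_face_sum: "face_sum (face_sum c) s = 0"
  by (induction s arbitrary: c) (auto simp: face_sum_diff)

text \<open>Applied to extracting a coefficient and to placing a scalar at a monomial;
  \<open>h 0 = 0\<close> follows from the assumption.\<close>

lemma face_sum_hom:
  "(\<And>x y. h (x - y) = h x - h y) \<Longrightarrow> face_sum (\<lambda>s. h (c s)) s = h (face_sum c s)"
proof (induction s arbitrary: c)
  case Nil
  have "h (0 - 0) = h 0 - h 0" by (rule Nil)
  then show ?case by simp
qed simp

lemma face_sum_nonzeroE:
  assumes "face_sum c s \<noteq> 0"
  obtains t where "c t \<noteq> 0" "set t \<subseteq> set s" "length s = Suc (length t)"
proof -
  have "\<exists>t. c t \<noteq> 0 \<and> set t \<subseteq> set s \<and> length s = Suc (length t)"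
    using assms
  proof (induction s arbitrary: c)
    case (Cons x s)
    show ?case
    proof (cases "c s = 0")
      case True
      then have "face_sum (\<lambda>t. c (x # t)) s \<noteq> 0" using Cons.prems by simp
      then obtain t where "c (x # t) \<noteq> 0" "set t \<subseteq> set s" "length s = Suc (length t)"
        using Cons.IH by blast
      then show ?thesis by (intro exI[of _ "x # t"]) auto
    qed auto
  qed simp
  then show ?thesis using that by blast
qed

text \<open>Deleting the head is the term \<open>j = 0\<close>; all other faces keep the head and
  have their index shifted by one, hence the minus sign in the recursion.\<close>

lemma face_sum_eq_sum:
  "face_sum c s = (\<Sum>j<length s. if even j then c (take j s @ drop (Suc j) s)
                                  else - c (take j s @ drop (Suc j) s))"
proof (induction s arbitrary: c)
  case (Cons x s)
  show ?case
    unfolding face_sum.simps Cons.IH list.size sum.lessThan_Suc_shift sum_negf[symmetric]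
      diff_conv_add_uminus add_0_right add_Suc_right
    by (auto intro!: sum.cong)
qed simp

definition cob :: "'v set \<Rightarrow> ('v list \<Rightarrow> 'b::ab_group_add) \<Rightarrow> 'v list \<Rightarrow> 'b" where
  "cob V c = (\<lambda>s. if set s \<subseteq> V then face_sum c s else 0)"

definition restr :: "'v set \<Rightarrow> ('v list \<Rightarrow> 'b::ab_group_add) \<Rightarrow> 'v list \<Rightarrow> 'b" where
  "restr V c = (\<lambda>s. if set s \<subseteq> V then c s else 0)"

lemma cob_cob: "cob V (cob V c) = (\<lambda>_. 0)"
proof -
  have "face_sum (cob V c) s = 0" if "set s \<subseteq> V" for s
    using that face_sum_face_sum[of c s]
    by (subst face_sum_cong[of s _ "face_sum c"]) (auto simp: cob_def)
  then show ?thesis by (auto simp: cob_def)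
qed

lemma cob_diff: "cob V (\<lambda>s. b s - c s) = (\<lambda>s. cob V b s - cob V c s)"
  by (auto simp: cob_def face_sum_diff)

lemma cob_zero: "cob V (\<lambda>_. 0) = (\<lambda>_. 0)"
  using cob_diff[of V "\<lambda>_. 0" "\<lambda>_. 0"] by simp

lemma cob_restr: "V' \<subseteq> V \<Longrightarrow> cob V' (restr V' c) = restr V' (cob V c)"
proof (rule ext)
  fix s
  assume V': "V' \<subseteq> V"
  have "face_sum (restr V' c) s = face_sum c s" if "set s \<subseteq> V'"
    using that by (intro face_sum_cong) (auto simp: restr_def)
  then show "cob V' (restr V' c) s = restr V' (cob V c) s"
    using V' by (auto simp: cob_def restr_def)
qed

text \<open>
  For upward closed \<open>P\<close>, the cochains on the full simplex with vertex set \<open>V\<close> relative to the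
  subcomplex of faces violating \<open>P\<close>.
\<close>

definition supported :: "'v set \<Rightarrow> ('v set \<Rightarrow> bool) \<Rightarrow> int \<Rightarrow> ('v list \<Rightarrow> 'b::ab_group_add) set" where
  "supported V P q =
    {c. \<forall>s. c s \<noteq> 0 \<longrightarrow> s \<noteq> [] \<and> int (length s) = q + 1 \<and> set s \<subseteq> V \<and> P (set s)}"

text \<open>The type token fixes the coefficients, which \<open>V\<close>, \<open>P\<close> and
  \<open>q\<close> leave open.\<close>

definition exact_at :: "'b::ab_group_add itself \<Rightarrow> 'v set \<Rightarrow> ('v set \<Rightarrow> bool) \<Rightarrow> int \<Rightarrow> bool" where
  "exact_at _ V P q \<longleftrightarrow> (\<forall>c \<in> supported V P q. cob V c = (\<lambda>_. 0 :: 'b) \<longrightarrow>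
     c \<in> cob V ` supported V P (q - 1))"

lemma supported_cong:
  assumes "\<And>S. S \<subseteq> V \<Longrightarrow> S \<noteq> {} \<Longrightarrow> P S \<longleftrightarrow> Q S"
  shows "supported V P q = supported V Q q"
proof -
  have "P (set s) \<longleftrightarrow> Q (set s)" if "set s \<subseteq> V" "s \<noteq> []" for s
    using that assms by simp
  then show ?thesis unfolding supported_def by blast
qed

lemma exact_at_cong:
  "(\<And>S. S \<subseteq> V \<Longrightarrow> S \<noteq> {} \<Longrightarrow> P S \<longleftrightarrow> Q S) \<Longrightarrow> exact_at K V P q \<longleftrightarrow> exact_at K V Q q"
  unfolding exact_at_def using supported_cong[of V P Q] by metis

lemma supported_diff:
  "b \<in> supported V P q \<Longrightarrow> c \<in> supported V P q \<Longrightarrow> (\<lambda>s. b s - c s) \<in> supported V P q"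
  unfolding supported_def mem_Collect_eq by (metis diff_self)

text \<open>A tuple with nonzero coboundary has a face in the support of \<open>c\<close>, and
  upward closure passes \<open>P\<close> on from that face.\<close>

lemma cob_supported:
  assumes P: "\<And>S T. P S \<Longrightarrow> S \<subseteq> T \<Longrightarrow> P T" and c: "c \<in> supported V P q"
  shows "cob V c \<in> supported V P (q + 1)"
  unfolding supported_def mem_Collect_eq
proof (intro allI impI)
  fix s assume "cob V c s \<noteq> 0"
  then have s: "set s \<subseteq> V" "face_sum c s \<noteq> 0" by (auto simp: cob_def split: if_splits)
  from face_sum_nonzeroE[OF s(2)] obtain t
    where t: "c t \<noteq> 0" "set t \<subseteq> set s" "length s = Suc (length t)" .
  then have "int (length t) = q + 1" "P (set t)" using c by (auto simp: supported_def)
  then show "s \<noteq> [] \<and> int (length s) = (q + 1) + 1 \<and> set s \<subseteq> V \<and> P (set s)"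
    using t s P by auto
qed

lemma restr_supported: "V' \<subseteq> V \<Longrightarrow> c \<in> supported V P q \<Longrightarrow> restr V' c \<in> supported V' P q"
  by (auto simp: supported_def restr_def)

lemma restr_supported_eq: "c \<in> supported V P q \<Longrightarrow> restr V c = c"
  by (rule ext) (auto simp: supported_def restr_def)

lemma supported_mono:
  "V' \<subseteq> V \<Longrightarrow> (\<And>S. S \<subseteq> V' \<Longrightarrow> P S \<Longrightarrow> Q S) \<Longrightarrow> supported V' P q \<subseteq> supported V Q q"
  by (auto simp: supported_def)

text \<open>With \<open>restr_escape\<close>, this identifies the kernel of restriction to
  \<open>V'\<close>.\<close>

lemma supported_escape:
  assumes "c \<in> supported V P q" "restr V' c = (\<lambda>_. 0)"
  shows "c \<in> supported V (\<lambda>S. P S \<and> \<not> S \<subseteq> V') q"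
proof -
  have "c s = 0" if "set s \<subseteq> V'" for s
    using that fun_cong[OF assms(2), of s] by (simp add: restr_def)
  then show ?thesis using assms(1) by (auto simp: supported_def)
qed

lemma restr_escape:
  "c \<in> supported V (\<lambda>S. P S \<and> \<not> S \<subseteq> V') q \<Longrightarrow> restr V' c = (\<lambda>_. 0)"
  by (rule ext) (auto simp: supported_def restr_def)

text \<open>
  The long exact sequence for restriction of cochains from \<open>V\<close> to \<open>V'\<close>, when the middle term
  is exact.
\<close>

lemma exact_escape_iff:
  fixes K :: "'b::ab_group_add itself"
  assumes P: "\<And>S T. P S \<Longrightarrow> S \<subseteq> T \<Longrightarrow> P T" and V': "V' \<subseteq> V"
    and ex: "exact_at K V P q" "exact_at K V P (q - 1)"
  shows "exact_at K V (\<lambda>S. P S \<and> \<not> S \<subseteq> V') q \<longleftrightarrow> exact_at K V' P (q - 1)"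
    (is "exact_at K V ?Q q \<longleftrightarrow> _")
proof
  assume ex': "exact_at K V' P (q - 1)"
  show "exact_at K V ?Q q"
    unfolding exact_at_def
  proof (intro ballI impI)
    fix c :: "'a list \<Rightarrow> 'b"
    assume c: "c \<in> supported V ?Q q" "cob V c = (\<lambda>_. 0)"
    have "c \<in> supported V P q" using c(1) by (auto simp: supported_def)
    with ex(1) c(2) obtain b where b: "b \<in> supported V P (q - 1)" "c = cob V b"
      unfolding exact_at_def by blast
    have "cob V' (restr V' b) = (\<lambda>_. 0)"
      unfolding cob_restr[OF V'] b(2)[symmetric] by (rule restr_escape[OF c(1)])
    then obtain g where g: "g \<in> supported V' P (q - 1 - 1)" "restr V' b = cob V' g"
      using ex' restr_supported[OF V' b(1)] unfolding exact_at_def by blast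
    \<comment> \<open>Extended by zero to \<open>V\<close>, \<open>g\<close> corrects
      \<open>b\<close>: subtracting \<open>cob V g\<close> keeps the coboundary \<open>c\<close> and
      kills the restriction to \<open>V'\<close>.\<close>
    have gV: "g \<in> supported V P (q - 1 - 1)"
      using g(1) supported_mono[OF V', of P P] by blast
    have rg: "restr V' g = g"
      using g(1) by (rule restr_supported_eq)
    have "restr V' (\<lambda>s. b s - cob V g s) = (\<lambda>_. 0)"
    proof -
      have "restr V' b = restr V' (cob V g)"
        using g(2) rg cob_restr[OF V', of g] by simp
      then show ?thesis by (auto simp: restr_def fun_eq_iff split: if_splits)
    qed
    moreover have "(\<lambda>s. b s - cob V g s) \<in> supported V P (q - 1)"
      using supported_diff[OF b(1)] cob_supported[OF P gV] by simp
    ultimately have "(\<lambda>s. b s - cob V g s) \<in> supported V ?Q (q - 1)"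
      by (intro supported_escape)
    moreover have "cob V (\<lambda>s. b s - cob V g s) = c"
      by (simp add: cob_diff cob_cob b(2))
    ultimately show "c \<in> cob V ` supported V ?Q (q - 1)" by blast
  qed
next
  assume ex': "exact_at K V ?Q q"
  show "exact_at K V' P (q - 1)"
    unfolding exact_at_def
  proof (intro ballI impI)
    fix b :: "'a list \<Rightarrow> 'b"
    assume b: "b \<in> supported V' P (q - 1)" "cob V' b = (\<lambda>_. 0)"
    \<comment> \<open>The connecting map: extend the cocycle \<open>b\<close> by zero and take its
      coboundary on \<open>V\<close>.\<close>
    have bV: "b \<in> supported V P (q - 1)"
      using b(1) supported_mono[OF V', of P P] by blast
    have rb: "restr V' b = b"
      using b(1) by (rule restr_supported_eq)
    have "restr V' (cob V b) = (\<lambda>_. 0)"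
      using b(2) rb cob_restr[OF V', of b] by simp
    then have "cob V b \<in> supported V ?Q q"
      using cob_supported[OF P bV] by (intro supported_escape) auto
    then obtain f where f: "f \<in> supported V ?Q (q - 1)" "cob V b = cob V f"
      using ex' cob_cob[of V b] unfolding exact_at_def by blast
    have fV: "f \<in> supported V P (q - 1)" using f(1) by (auto simp: supported_def)
    \<comment> \<open>The difference of \<open>b\<close> and \<open>f\<close> has a primitive
      \<open>h\<close> on \<open>V\<close>; since \<open>f\<close> vanishes on \<open>V'\<close>,
      restricting \<open>h\<close> gives a primitive of \<open>b\<close>.\<close>
    have "cob V (\<lambda>s. b s - f s) = (\<lambda>_. 0)" by (simp add: cob_diff f(2))
    then obtain h where h: "h \<in> supported V P (q - 1 - 1)" "(\<lambda>s. b s - f s) = cob V h"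
      using ex(2) supported_diff[OF bV fV] unfolding exact_at_def by blast
    have "b = restr V' (\<lambda>s. b s - f s)"
      using rb restr_escape[OF f(1)] by (auto simp: restr_def fun_eq_iff split: if_splits)
    also have "\<dots> = cob V' (restr V' h)" by (simp add: h(2) cob_restr[OF V'])
    finally show "b \<in> cob V' ` supported V' P (q - 1 - 1)"
      using restr_supported[OF V' h(1)] by blast
  qed
qed

text \<open>Prepending \<open>w\<close> is a contraction: the cocycle identity at
  \<open>w # s\<close> writes \<open>c s\<close> as a coboundary. The assumption on \<open>q\<close>
  makes \<open>c [w]\<close> zero, which would otherwise become a value at the empty tuple.\<close>

lemma exact_cone:
  assumes w: "w \<in> V" "\<And>S. P (insert w S) \<Longrightarrow> P S" and q: "q \<noteq> 0 \<or> \<not> P {w}"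
  shows "exact_at K V P q"
  unfolding exact_at_def
proof (intro ballI impI)
  fix c :: "'a list \<Rightarrow> 'b"
  assume c: "c \<in> supported V P q" "cob V c = (\<lambda>_. 0)"
  have "c [w] = 0" using c(1) q by (auto simp: supported_def)
  then have b: "(\<lambda>s. c (w # s)) \<in> supported V P (q - 1)"
    using c(1) w(2) unfolding supported_def by fastforce
  have "cob V (\<lambda>s. c (w # s)) s = c s" for s
  proof (cases "set s \<subseteq> V")
    case True
    then have "cob V c (w # s) = c s - face_sum (\<lambda>s. c (w # s)) s"
      using w by (simp add: cob_def)
    then show ?thesis using True fun_cong[OF c(2), of "w # s"] by (simp add: cob_def)
  next
    case False
    then show ?thesis using c(1) by (auto simp: cob_def supported_def)
  qed
  then have "c = cob V (\<lambda>s. c (w # s))" by (rule ext[OF sym])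
  then show "c \<in> cob V ` supported V P (q - 1)" using b by blast
qed

text \<open>The constant 0-cochain 1 is a nonzero cocycle, but degree -1 has only the zero
  cochain.\<close>

lemma not_exact_zero:
  fixes K :: "'b::ring_1 itself"
  assumes w: "w \<in> V" and P: "\<And>S. P S"
  shows "\<not> exact_at K V P 0"
proof
  assume ex: "exact_at K V P 0"
  define c :: "'a list \<Rightarrow> 'b" where "c = (\<lambda>s. if length s = 1 \<and> set s \<subseteq> V then 1 else 0)"
  have "c \<in> supported V P 0" using P by (auto simp: supported_def c_def)
  moreover have "cob V c = (\<lambda>_. 0)"
  proof (rule ext, rule ccontr)
    fix s assume nz: "cob V c s \<noteq> 0"
    then have s: "set s \<subseteq> V" "face_sum c s \<noteq> 0" by (auto simp: cob_def split: if_splits)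
    from face_sum_nonzeroE[OF s(2)] obtain t where "c t \<noteq> 0" "length s = Suc (length t)" .
    then have "length s = 2" by (simp add: c_def split: if_splits)
    then obtain x y where "s = [x, y]" by (auto simp: numeral_2_eq_2 length_Suc_conv)
    then show False using s by (simp add: c_def)
  qed
  ultimately obtain b where b: "b \<in> supported V P (0 - 1)" "c = cob V b"
    using ex unfolding exact_at_def by blast
  have "b = (\<lambda>_. 0)" using b(1) by (auto simp: supported_def)
  then have "c [w] = 0" using b(2) by (simp add: cob_zero)
  then show False using w by (simp add: c_def)
qed

section \<open>Boxes of cover indices\<close>

definition box :: "('r \<Rightarrow> nat set) \<Rightarrow> ('r \<Rightarrow> nat) set" where
  "box W = {v. \<forall>k. v k \<in> W k}"

text \<open>For \<open>N k\<close> the indices of negative exponents in factor \<open>k\<close>,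
  this says that the monomial is regular on the intersection of the \<open>U\<^sub>v\<close> with
  \<open>v\<close> in \<open>S\<close>.\<close>

definition covers :: "('r \<Rightarrow> nat set) \<Rightarrow> ('r \<Rightarrow> nat) set \<Rightarrow> bool" where
  "covers N S \<longleftrightarrow> (\<forall>k. N k \<subseteq> (\<lambda>v. v k) ` S)"

lemma covers_mono: "covers N S \<Longrightarrow> S \<subseteq> T \<Longrightarrow> covers N T"
  unfolding covers_def by blast

lemma covers_remove:
  assumes "x \<in> N k"
  shows "covers N S \<longleftrightarrow> covers (N(k := N k - {x})) S \<and> x \<in> (\<lambda>v. v k) ` S"
proof
  assume *: "covers (N(k := N k - {x})) S \<and> x \<in> (\<lambda>v. v k) ` S"
  show "covers N S"
    unfolding covers_def
  proof (intro allI subsetI)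
    fix j i assume "i \<in> N j"
    then have "i \<in> (N(k := N k - {x})) j \<or> (j = k \<and> i = x)" by auto
    then show "i \<in> (\<lambda>v. v j) ` S" using * unfolding covers_def by blast
  qed
next
  assume "covers N S"
  then show "covers (N(k := N k - {x})) S \<and> x \<in> (\<lambda>v. v k) ` S"
    using assms unfolding covers_def by (metis Diff_subset fun_upd_apply in_mono subset_trans)
qed

text \<open>
  This turns out to describe the degrees \<open>q\<close> in which the cohomology is nonzero. A one-element
  \<open>W k\<close> may count as full or not: it contributes 0 to the degree.
\<close>

definition concentrated :: "('r::finite \<Rightarrow> nat set) \<Rightarrow> ('r \<Rightarrow> nat set) \<Rightarrow> int \<Rightarrow> bool" where
  "concentrated W N q \<longleftrightarrow> (\<forall>k. N k = {} \<or> N k = W k) \<and>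
     q = (\<Sum>k\<in>UNIV. if N k = W k then int (card (W k)) - 1 else 0)"

text \<open>Induction on the number of required values. If \<open>N k = W k\<close> has two
  elements, dropping one gives a restriction sequence with exact middle term, which shifts the
  degree by one. If \<open>N k = W k\<close> is a singleton, its condition is automatic for nonempty
  sets. Otherwise a point outside all \<open>N k\<close> is a cone vertex, and only the constants in
  degree 0 with nothing required survive.\<close>

lemma exact_box_iff:
  fixes W N :: "'r::finite \<Rightarrow> nat set" and K :: "'b::ring_1 itself"
  assumes "\<And>k. finite (W k)" "\<And>k. W k \<noteq> {}" "\<And>k. N k \<subseteq> W k"
  shows "exact_at K (box W) (covers N) q \<longleftrightarrow> \<not> concentrated W N q"
  using assms
proof (induction "\<Sum>k\<in>UNIV. card (N k)" arbitrary: W N q rule: less_induct)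
  case (less N W)
  note fin = less.prems(1) and ne = less.prems(2) and sub = less.prems(3)
  have finN: "finite (N k)" for k using fin sub finite_subset by blast
  have decr: "(\<Sum>j\<in>UNIV. card ((N(k := N k - {x})) j)) < (\<Sum>j\<in>UNIV. card (N j))"
    if "x \<in> N k" for k x
  proof (rule sum_strict_mono_ex1)
    have "card ((N(k := N k - {x})) k) < card (N k)"
      using card_Diff1_less[OF finN that] by (simp only: fun_upd_same)
    then show "\<exists>j\<in>UNIV. card ((N(k := N k - {x})) j) < card (N j)" by blast
  qed (auto intro!: card_mono finN)
  consider (big) k x y where "N k = W k" "x \<in> W k" "y \<in> W k" "x \<noteq> y"
    | (single) k x where "N k = W k" "W k = {x}"
    | (none) "\<And>k. N k \<noteq> W k"
  proof (cases "\<exists>k. N k = W k")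
    case True
    then obtain k x where k: "N k = W k" "x \<in> W k" using ne by blast
    show ?thesis
    proof (cases "W k = {x}")
      case False
      then obtain y where "y \<in> W k" "x \<noteq> y" using k by blast
      then show ?thesis using big k by blast
    qed (use single k in blast)
  qed (use none in blast)
  then show ?case
  proof cases
    case big
    define N' where "N' = N(k := N k - {x})"
    define W' where "W' = W(k := W k - {x})"
    have dec: "(\<Sum>j\<in>UNIV. card (N' j)) < (\<Sum>j\<in>UNIV. card (N j))"
      unfolding N'_def using big by (intro decr) auto
    have N'W: "N' j \<subseteq> W j" for j
      using sub[of j] by (auto simp: N'_def)
    \<comment> \<open>\<open>N' k\<close> contains \<open>y\<close> but not \<open>x\<close>, so it
      is neither empty nor all of \<open>W k\<close>.\<close>
    have "\<not> concentrated W N' q'" for q'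
      using big by (auto simp: concentrated_def N'_def intro!: exI[of _ k])
    then have ex: "exact_at K (box W) (covers N') q'" for q'
      using less.hyps[OF dec fin ne N'W, of q'] by simp
    have IH: "exact_at K (box W') (covers N') (q - 1) \<longleftrightarrow> \<not> concentrated W' N' (q - 1)"
    proof (rule less.hyps[OF dec])
      show "finite (W' j)" for j using fin by (simp add: W'_def)
      show "W' j \<noteq> {}" for j using ne[of j] big by (auto simp: W'_def)
      show "N' j \<subseteq> W' j" for j using sub[of j] by (auto simp: N'_def W'_def)
    qed
    have iff: "N' j = {} \<longleftrightarrow> N j = {}" "N' j = W' j \<longleftrightarrow> N j = W j" for j
      using big by (auto simp: N'_def W'_def)
    define f where "f = (\<lambda>j. if N j = W j then int (card (W j)) - 1 else 0)"
    define f' where "f' = (\<lambda>j. if N' j = W' j then int (card (W' j)) - 1 else 0)"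
    \<comment> \<open>Removing \<open>x\<close> lowers only the \<open>k\<close>-th summand, by
      one.\<close>
    have "int (card (W k)) = 1 + int (card (W' k))"
      using card.remove[OF fin big(2)] by (simp add: W'_def)
    then have "f k = 1 + f' k" using iff(2)[of k] big(1) by (simp add: f_def f'_def)
    moreover have "f j = f' j" if "j \<noteq> k" for j
      using that by (simp add: f_def f'_def iff) (simp add: W'_def)
    ultimately have "sum f UNIV = 1 + sum f' UNIV"
      by (simp add: sum.remove[of UNIV k f] sum.remove[of UNIV k f'])
    then have conc: "concentrated W N q \<longleftrightarrow> concentrated W' N' (q - 1)"
      unfolding concentrated_def f_def f'_def iff by auto
    \<comment> \<open>Inside \<open>box W\<close>, hitting \<open>x\<close> in coordinate
      \<open>k\<close> means leaving \<open>box W'\<close>, so the complex for \<open>N\<close> is a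
      kernel of restriction.\<close>
    have "exact_at K (box W) (covers N) q
        \<longleftrightarrow> exact_at K (box W) (\<lambda>S. covers N' S \<and> \<not> S \<subseteq> box W') q"
    proof (rule exact_at_cong)
      fix S assume S: "S \<subseteq> box W"
      have "S \<subseteq> box W' \<longleftrightarrow> x \<notin> (\<lambda>v. v k) ` S"
        using S by (auto simp: box_def W'_def)
      then show "covers N S \<longleftrightarrow> covers N' S \<and> \<not> S \<subseteq> box W'"
        using covers_remove[of x N k S] big by (simp add: N'_def)
    qed
    also have "\<dots> \<longleftrightarrow> exact_at K (box W') (covers N') (q - 1)"
    proof (rule exact_escape_iff[OF covers_mono _ ex ex])
      show "box W' \<subseteq> box W" by (auto simp: box_def W'_def split: if_splits)
    qed
    finally show ?thesis using IH conc by simp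
  next
    case single
    define N' where "N' = N(k := N k - {x})"
    have dec: "(\<Sum>j\<in>UNIV. card (N' j)) < (\<Sum>j\<in>UNIV. card (N j))"
      unfolding N'_def using single by (intro decr) auto
    have "exact_at K (box W) (covers N) q \<longleftrightarrow> exact_at K (box W) (covers N') q"
    proof (rule exact_at_cong)
      fix S assume S: "S \<subseteq> box W" "S \<noteq> {}"
      then have "x \<in> (\<lambda>v. v k) ` S" using single(2) by (force simp: box_def)
      then show "covers N S \<longleftrightarrow> covers N' S"
        using covers_remove[of x N k S] single by (simp add: N'_def)
    qed
    also have "\<dots> \<longleftrightarrow> \<not> concentrated W N' q"
    proof (rule less.hyps[OF dec fin ne])
      show "N' j \<subseteq> W j" for j using sub[of j] by (auto simp: N'_def)
    qed
    also have "concentrated W N' q \<longleftrightarrow> concentrated W N q"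
    proof -
      have "(\<Sum>j\<in>UNIV. if N' j = W j then int (card (W j)) - 1 else 0)
          = (\<Sum>j\<in>UNIV. if N j = W j then int (card (W j)) - 1 else 0)"
        by (rule sum.cong) (auto simp: N'_def single)
      moreover have "(N' j = {} \<or> N' j = W j) \<longleftrightarrow> (N j = {} \<or> N j = W j)" for j
        by (auto simp: N'_def single)
      ultimately show ?thesis unfolding concentrated_def by simp
    qed
    finally show ?thesis .
  next
    case none
    then have "\<forall>k. \<exists>i. i \<in> W k \<and> i \<notin> N k" using sub by blast
    then obtain w where w: "\<And>k. w k \<in> W k" "\<And>k. w k \<notin> N k" by metis
    have wb: "w \<in> box W" using w by (simp add: box_def)
    have conc: "concentrated W N q \<longleftrightarrow> (\<forall>k. N k = {}) \<and> q = 0"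
      using none by (auto simp: concentrated_def)
    show ?thesis
    proof (cases "(\<forall>k. N k = {}) \<and> q = 0")
      case True
      then have "\<not> exact_at K (box W) (covers N) 0"
        by (intro not_exact_zero[OF wb]) (simp add: covers_def)
      then show ?thesis using True conc by simp
    next
      case False
      have "exact_at K (box W) (covers N) q"
      proof (rule exact_cone[OF wb])
        \<comment> \<open>The point \<open>w\<close> takes no value in any \<open>N k\<close>, so
          adjoining it meets no requirement.\<close>
        show "covers N S" if "covers N (insert w S)" for S
          using that w(2) unfolding covers_def by (metis image_insert subset_insert)
        show "q \<noteq> 0 \<or> \<not> covers N {w}"
          using False w(2) by (auto simp: covers_def)
      qed
      then show ?thesis using False conc by simp
    qed
  qed
qed

section \<open>Cohomology of line bundles\<close>

lemma coboundary_eq_cob: "coboundary l c = cob (cover_index l) c"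
  by (rule ext) (simp add: coboundary_def cob_def face_sum_eq_sum cong: if_cong)

text \<open>The coset of \<open>x\<close> contains \<open>x\<close>, so the quotient has only one
  coset iff every cocycle is a coboundary.\<close>

lemma trivial_cohomology_iff:
  fixes K :: "'k::field itself"
  shows "trivial_group (cohomology K l q a) \<longleftrightarrow>
    (cocycles l a q :: ('r, 'k) cochain set) \<subseteq> coboundary l ` cochains l a (q - 1)"
proof -
  define G :: "('r, 'k) cochain monoid" where "G = cocycle_group l a q"
  define H :: "('r, 'k) cochain set" where "H = coboundary l ` cochains l a (q - 1)"
  have H_sub: "H \<subseteq> cocycles l a q"
    using coboundary_cochains[of _ l a "q - 1"]
    by (auto simp: H_def cocycles_def coboundary_coboundary)
  have zero: "(\<lambda>_. 0) \<in> H"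
    unfolding H_def by (rule image_eqI[of _ _ "\<lambda>_. 0"]) (simp_all add: coboundary_zero cochains_zero)
  have add: "(\<lambda>s. b s + c s) \<in> H" if "b \<in> H" "c \<in> H" for b c
    using that by (auto simp: H_def coboundary_add[symmetric] intro!: imageI cochains_add)
  have neg: "(\<lambda>s. - c s) \<in> H" if "c \<in> H" for c
    using that by (auto simp: H_def coboundary_uminus[symmetric] intro!: imageI cochains_uminus)
  have coset: "H #>\<^bsub>G\<^esub> x = (\<lambda>h s. h s + x s) ` H" for x
    by (auto simp: r_coset_def G_def cocycle_group_def)
  have "trivial_group (cohomology K l q a) \<longleftrightarrow>
      (\<lambda>x. H #>\<^bsub>G\<^esub> x) ` cocycles l a q = {H}"
  proof -
    have "rcosets\<^bsub>G\<^esub> H = (\<lambda>x. H #>\<^bsub>G\<^esub> x) ` cocycles l a q"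
      by (simp add: RCOSETS_def UNION_singleton_eq_range G_def cocycle_group_def)
    moreover have "carrier (cohomology K l q a) = rcosets\<^bsub>G\<^esub> H" "\<one>\<^bsub>cohomology K l q a\<^esub> = H"
      by (simp_all add: cohomology_def FactGroup_def G_def H_def)
    ultimately show ?thesis by (simp add: trivial_group_def group_cohomology)
  qed
  also have "\<dots> \<longleftrightarrow> cocycles l a q \<subseteq> H"
  proof
    assume *: "(\<lambda>x. H #>\<^bsub>G\<^esub> x) ` cocycles l a q = {H}"
    show "cocycles l a q \<subseteq> H"
    proof
      fix x :: "('r, 'k) cochain" assume "x \<in> cocycles l a q"
      then have "H #>\<^bsub>G\<^esub> x = H" using * by blast
      moreover have "x \<in> H #>\<^bsub>G\<^esub> x"
        unfolding coset using zero by (intro image_eqI[of _ _ "\<lambda>_. 0"]) auto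
      ultimately show "x \<in> H" by simp
    qed
  next
    assume "cocycles l a q \<subseteq> H"
    then have eq: "cocycles l a q = H" using H_sub by blast
    have "H #>\<^bsub>G\<^esub> x = H" if "x \<in> H" for x
    proof
      show "H #>\<^bsub>G\<^esub> x \<subseteq> H" using add that by (auto simp: coset)
      show "H \<subseteq> H #>\<^bsub>G\<^esub> x"
      proof
        fix y assume "y \<in> H"
        then show "y \<in> H #>\<^bsub>G\<^esub> x"
          unfolding coset using add[OF _ neg[OF that]] by (intro image_eqI[of _ _ "\<lambda>s. y s + - x s"]) auto
      qed
    qed
    then show "(\<lambda>x. H #>\<^bsub>G\<^esub> x) ` cocycles l a q = {H}"
      using zero unfolding eq by auto
  qed
  finally show ?thesis unfolding H_def .
qed

section \<open>Splitting of the Cech complex over Laurent monomials\<close>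

definition neg_part :: "('r \<Rightarrow> nat) \<Rightarrow> ('r \<Rightarrow> nat \<Rightarrow> int) \<Rightarrow> 'r \<Rightarrow> nat set" where
  "neg_part l e k = {i. i \<le> l k \<and> e k i < 0}"

definition exponents :: "('r \<Rightarrow> nat) \<Rightarrow> ('r \<Rightarrow> int) \<Rightarrow> ('r \<Rightarrow> nat \<Rightarrow> int) set" where
  "exponents l a = {e. \<forall>k. (\<forall>i > l k. e k i = 0) \<and> (\<Sum>i\<le>l k. e k i) = a k}"

lemma sections_iff:
  "f \<in> sections l a V \<longleftrightarrow>
    (\<forall>e \<in> Poly_Mapping.keys f. e \<in> exponents l a \<and> covers (neg_part l e) V)"
proof -
  have "covers (neg_part l e) V \<longleftrightarrow> (\<forall>k. \<forall>i \<le> l k. e k i < 0 \<longrightarrow> (\<exists>v\<in>V. v k = i))" for e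
    by (auto simp: covers_def neg_part_def)
  then show ?thesis unfolding sections_def exponents_def by blast
qed

lemma cochain_coefficient:
  assumes "c \<in> cochains l a q"
  shows "(\<lambda>s. Poly_Mapping.lookup (c s) e) \<in> supported (cover_index l) (covers (neg_part l e)) q"
  unfolding supported_def mem_Collect_eq
proof (intro allI impI)
  fix s assume "Poly_Mapping.lookup (c s) e \<noteq> 0"
  then have "c s \<noteq> 0" "e \<in> Poly_Mapping.keys (c s)" by (auto simp: in_keys_iff)
  then show "s \<noteq> [] \<and> int (length s) = q + 1 \<and> set s \<subseteq> cover_index l \<and>
      covers (neg_part l e) (set s)"
    using assms unfolding cochains_def sections_iff by blast
qed

lemma coefficient_cob: "Poly_Mapping.lookup (cob V c s) e = cob V (\<lambda>s. Poly_Mapping.lookup (c s) e) s"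
  by (simp add: cob_def face_sum_hom[where h = "\<lambda>f. Poly_Mapping.lookup f e"] lookup_minus)

lemma finite_cover_index: "finite (cover_index (l :: 'r::finite \<Rightarrow> nat))"
proof -
  have "cover_index l = (\<Pi>\<^sub>E k\<in>UNIV. {..l k})"
    by (auto simp: cover_index_def PiE_def)
  then show ?thesis by (simp add: finite_PiE)
qed

text \<open>The support consists of tuples of fixed length over a finite cover. Finiteness lets
  primitives found for single monomials be assembled into Laurent polynomials.\<close>

lemma finite_cochain_keys:
  assumes "c \<in> cochains (l :: 'r::finite \<Rightarrow> nat) a q"
  shows "finite (\<Union>s. Poly_Mapping.keys (c s))"
proof -
  have "(\<Union>s. Poly_Mapping.keys (c s))
      \<subseteq> (\<Union>s\<in>{s. set s \<subseteq> cover_index l \<and> length s = nat (q + 1)}. Poly_Mapping.keys (c s))"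
  proof safe
    fix s e assume e: "e \<in> Poly_Mapping.keys (c s)"
    then have "c s \<noteq> 0" by auto
    then have "set s \<subseteq> cover_index l" "length s = nat (q + 1)"
      using assms unfolding cochains_def by auto
    then show "e \<in> (\<Union>s\<in>{s. set s \<subseteq> cover_index l \<and> length s = nat (q + 1)}.
        Poly_Mapping.keys (c s))"
      using e by blast
  qed
  moreover have "finite \<dots>"
    using finite_lists_length_eq[OF finite_cover_index[of l]] by auto
  ultimately show ?thesis by (rule finite_subset)
qed

lemma trivial_cohomology_iff_exact:
  fixes K :: "'k::field itself" and l :: "'r::finite \<Rightarrow> nat"
  shows "trivial_group (cohomology K l q a) \<longleftrightarrow>
    (\<forall>e\<in>exponents l a. exact_at K (cover_index l) (covers (neg_part l e)) q)"
  unfolding trivial_cohomology_iff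
proof (intro iffI ballI subsetI)
  fix e
  assume triv: "cocycles l a q \<subseteq> (coboundary l ` cochains l a (q - 1) :: ('r, 'k) cochain set)"
    and e: "e \<in> exponents l a"
  show "exact_at K (cover_index l) (covers (neg_part l e)) q"
    unfolding exact_at_def
  proof (intro ballI impI)
    fix c :: "('r \<Rightarrow> nat) list \<Rightarrow> 'k"
    assume c: "c \<in> supported (cover_index l) (covers (neg_part l e)) q"
      "cob (cover_index l) c = (\<lambda>_. 0)"
    define C where "C = (\<lambda>s. Poly_Mapping.single e (c s))"
    have keysC: "Poly_Mapping.keys (C s) = (if c s = 0 then {} else {e})" for s
      by (simp add: C_def)
    have "C s \<in> sections l a (set s)" for s
      using c(1) e unfolding sections_iff keysC by (auto simp: supported_def)
    moreover have "C s \<noteq> 0 \<longleftrightarrow> c s \<noteq> 0" for s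
      using keysC[of s] by (metis keys_eq_empty insert_not_empty)
    ultimately have "C \<in> cochains l a q"
      using c(1) unfolding cochains_def supported_def by auto
    moreover have "coboundary l C = (\<lambda>_. 0)"
    proof
      fix s
      have "coboundary l C s = Poly_Mapping.single e (cob (cover_index l) c s)"
        by (simp add: coboundary_eq_cob cob_def C_def single_diff
            face_sum_hom[where h = "Poly_Mapping.single e"])
      then show "coboundary l C s = 0" by (simp add: c(2))
    qed
    ultimately obtain B where B: "B \<in> cochains l a (q - 1)" "C = coboundary l B"
      using triv unfolding cocycles_def by blast
    have "c = cob (cover_index l) (\<lambda>s. Poly_Mapping.lookup (B s) e)"
    proof
      fix s
      have "c s = Poly_Mapping.lookup (C s) e" by (simp add: C_def)
      then show "c s = cob (cover_index l) (\<lambda>s. Poly_Mapping.lookup (B s) e) s"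
        by (simp add: B(2) coboundary_eq_cob coefficient_cob)
    qed
    then show "c \<in> cob (cover_index l) ` supported (cover_index l) (covers (neg_part l e)) (q - 1)"
      using cochain_coefficient[OF B(1), of e] by blast
  qed
next
  fix C :: "('r, 'k) cochain"
  let ?V = "cover_index l"
  let ?C = "\<lambda>e s. Poly_Mapping.lookup (C s) e"
  assume ex: "\<forall>e\<in>exponents l a. exact_at K ?V (covers (neg_part l e)) q"
    and "C \<in> cocycles l a q"
  then have C: "C \<in> cochains l a q" "coboundary l C = (\<lambda>_. 0)" by (auto simp: cocycles_def)
  \<comment> \<open>Taking \<open>b = 0\<close> where the coefficient vanishes keeps the assembled
    cochain finitely supported.\<close>
  have "\<exists>b. b \<in> supported ?V (covers (neg_part l e)) (q - 1) \<and> ?C e = cob ?V b \<and>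
      (?C e = (\<lambda>_. 0) \<longrightarrow> b = (\<lambda>_. 0))" for e
  proof (cases "?C e = (\<lambda>_. 0)")
    case True
    then show ?thesis
      by (intro exI[of _ "\<lambda>_. 0"]) (auto simp: supported_def cob_zero)
  next
    case False
    then obtain s where "e \<in> Poly_Mapping.keys (C s)" by (auto simp: in_keys_iff)
    then have "e \<in> exponents l a" using C(1) unfolding cochains_def sections_iff by blast
    moreover have "cob ?V (?C e) = (\<lambda>_. 0)"
      using C(2) by (simp add: coefficient_cob[symmetric] coboundary_eq_cob[symmetric] fun_eq_iff)
    ultimately show ?thesis
      using ex cochain_coefficient[OF C(1), of e] False unfolding exact_at_def by blast
  qed
  then obtain b where b: "\<And>e. b e \<in> supported ?V (covers (neg_part l e)) (q - 1)"
      "\<And>e. ?C e = cob ?V (b e)" "\<And>e. ?C e = (\<lambda>_. 0) \<Longrightarrow> b e = (\<lambda>_. 0)"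
    by metis
  have b_keys: "e \<in> (\<Union>s. Poly_Mapping.keys (C s))" if "b e s \<noteq> 0" for e s
  proof (rule ccontr)
    assume "e \<notin> (\<Union>s. Poly_Mapping.keys (C s))"
    then have "?C e = (\<lambda>_. 0)" by (auto simp: in_keys_iff)
    then show False using b(3) that by simp
  qed
  define B where "B = (\<lambda>s. Abs_poly_mapping (\<lambda>e. b e s))"
  have lookup_B: "Poly_Mapping.lookup (B s) e = b e s" for s e
    unfolding B_def
  proof (subst lookup_Abs_poly_mapping)
    show "finite {e. b e s \<noteq> 0}"
      using b_keys by (intro finite_subset[OF _ finite_cochain_keys[OF C(1)]]) auto
  qed simp
  have "B \<in> cochains l a (q - 1)"
    unfolding cochains_def mem_Collect_eq
  proof (intro allI conjI impI)
    fix s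
    show "B s \<in> sections l a (set s)"
      unfolding sections_iff
    proof
      fix e assume "e \<in> Poly_Mapping.keys (B s)"
      then have nz: "b e s \<noteq> 0" by (simp add: in_keys_iff lookup_B)
      have "e \<in> exponents l a"
        using b_keys[OF nz] C(1) unfolding cochains_def sections_iff by blast
      then show "e \<in> exponents l a \<and> covers (neg_part l e) (set s)"
        using nz b(1)[of e] by (auto simp: supported_def)
    qed
  next
    fix s assume "B s \<noteq> 0"
    then obtain e where "b e s \<noteq> 0" using poly_mapping_eqI[of "B s" 0] by (auto simp: lookup_B)
    then show "s \<noteq> []" "int (length s) = q - 1 + 1" "set s \<subseteq> ?V"
      using b(1)[of e] by (auto simp: supported_def)
  qed
  moreover have "C = coboundary l B"
  proof (rule ext, rule poly_mapping_eqI)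
    fix s e
    show "Poly_Mapping.lookup (C s) e = Poly_Mapping.lookup (coboundary l B s) e"
      using fun_cong[OF b(2)[of e], of s]
      by (simp add: coboundary_eq_cob coefficient_cob lookup_B)
  qed
  ultimately show "C \<in> coboundary l ` cochains l a (q - 1)" by blast
qed

text \<open>Kuenneth and Bott: cohomology comes from monomials whose exponents in each factor are
  all nonnegative or all negative. They sum to at least 0 or at most \<open>- l k - 1\<close>, so
  \<open>a\<close> decides the case for each factor and with it the degree.\<close>

lemma trivial_cohomology_line_bundle:
  fixes K :: "'k::field itself" and l :: "'r::finite \<Rightarrow> nat"
  shows "\<not> trivial_group (cohomology K l q a) \<longleftrightarrow>
    (\<forall>k. a k \<ge> 0 \<or> a k < - int (l k)) \<and>
    q = (\<Sum>k\<in>UNIV. if a k < - int (l k) then int (l k) else 0)"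
    (is "_ \<longleftrightarrow> ?bott")
proof -
  have V: "cover_index l = box (\<lambda>k. {..l k})" by (auto simp: cover_index_def box_def)
  have "\<not> trivial_group (cohomology K l q a) \<longleftrightarrow>
      (\<exists>e\<in>exponents l a. concentrated (\<lambda>k. {..l k}) (neg_part l e) q)"
  proof -
    have "exact_at K (cover_index l) (covers (neg_part l e)) q \<longleftrightarrow>
        \<not> concentrated (\<lambda>k. {..l k}) (neg_part l e) q" for e
      unfolding V by (rule exact_box_iff) (auto simp: neg_part_def)
    then show ?thesis unfolding trivial_cohomology_iff_exact by blast
  qed
  also have "\<dots> \<longleftrightarrow> ?bott"
  proof
    assume "\<exists>e\<in>exponents l a. concentrated (\<lambda>k. {..l k}) (neg_part l e) q"
    then obtain e where e: "e \<in> exponents l a"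
      and conc: "concentrated (\<lambda>k. {..l k}) (neg_part l e) q" by blast
    have deg: "(\<Sum>i\<le>l k. e k i) = a k" for k using e by (simp add: exponents_def)
    have empty: "a k \<ge> 0" if "neg_part l e k = {}" for k
      unfolding deg[symmetric] using that by (intro sum_nonneg) (auto simp: neg_part_def not_less)
    have full: "a k < - int (l k)" if "neg_part l e k = {..l k}" for k
    proof -
      have "(\<Sum>i\<le>l k. e k i) \<le> (\<Sum>i\<le>l k. - 1)"
      proof (rule sum_mono)
        fix i assume "i \<in> {..l k}"
        then have "e k i < 0" unfolding that[symmetric] by (simp add: neg_part_def)
        then show "e k i \<le> - 1" by simp
      qed
      then show ?thesis by (simp add: deg)
    qed
    have or: "neg_part l e k = {} \<or> neg_part l e k = {..l k}" for k
      using conc by (simp add: concentrated_def)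
    have iff: "neg_part l e k = {..l k} \<longleftrightarrow> a k < - int (l k)" for k
      using or[of k] empty[of k] full[of k] by auto
    have "a k \<ge> 0 \<or> a k < - int (l k)" for k using or[of k] empty[of k] full[of k] by blast
    then show ?bott
      using conc unfolding concentrated_def iff by (auto cong: if_cong)
  next
    assume bott: ?bott
    \<comment> \<open>In a factor with negative \<open>a k\<close> all exponents are -1 except the
      one at index 0, which takes the rest \<open>a k + l k\<close>, negative by
      \<open>bott\<close>.\<close>
    define e where "e = (\<lambda>k i. if i > l k then 0 else if a k \<ge> 0 then (if i = 0 then a k else 0)
        else if i = 0 then a k + int (l k) else - 1)"
    have "(\<Sum>i\<le>l k. e k i) = a k" for k
      by (simp add: e_def sum.atMost_shift)
    then have "e \<in> exponents l a" by (simp add: exponents_def e_def)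
    moreover have "concentrated (\<lambda>k. {..l k}) (neg_part l e) q"
    proof -
      have full: "neg_part l e k = {..l k}" if "a k < - int (l k)" for k
        using that by (auto simp: neg_part_def e_def)
      have empty: "neg_part l e k = {}" if "a k \<ge> 0" for k
        using that by (simp add: neg_part_def e_def)
      have or: "a k \<ge> 0 \<or> a k < - int (l k)" for k using bott by simp
      have iff: "neg_part l e k = {..l k} \<longleftrightarrow> a k < - int (l k)" for k
        using or[of k] full[of k] empty[of k] by auto
      have "neg_part l e k = {} \<or> neg_part l e k = {..l k}" for k
        using or[of k] full[of k] empty[of k] by blast
      then show ?thesis
        using bott unfolding concentrated_def iff by (simp cong: if_cong)
    qed
    ultimately show "\<exists>e\<in>exponents l a. concentrated (\<lambda>k. {..l k}) (neg_part l e) q" by blast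
  qed
  finally show ?thesis .
qed

section \<open>Determinantal vectors\<close>

definition admissible :: "('r::finite \<Rightarrow> nat) \<Rightarrow> ('r \<Rightarrow> nat) \<Rightarrow> ('r \<Rightarrow> int) \<Rightarrow> nat \<Rightarrow> bool" where
  "admissible l d m p \<longleftrightarrow> (\<forall>k. twist m p d k \<ge> 0 \<or> twist m p d k < - int (l k))"

text \<open>By Kuenneth, the only degree in which the twist by an admissible \<open>p\<close> has
  cohomology.\<close>

definition top_degree :: "('r::finite \<Rightarrow> nat) \<Rightarrow> ('r \<Rightarrow> nat) \<Rightarrow> ('r \<Rightarrow> int) \<Rightarrow> nat \<Rightarrow> int" where
  "top_degree l d m p = (\<Sum>k\<in>UNIV. if twist m p d k < - int (l k) then int (l k) else 0)"

lemma nontrivial_cohomology_twist: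
  "\<not> trivial_group (cohomology TYPE('k::field) l q (twist m p d)) \<longleftrightarrow>
    admissible l d m p \<and> q = top_degree l d m p"
  unfolding trivial_cohomology_line_bundle admissible_def top_degree_def ..

text \<open>An admissible \<open>p\<close> contributes only to the term of index \<open>p\<close>
  minus its top degree, with positive multiplicity.\<close>

lemma determinantal_iff:
  "determinantal TYPE('k::field) l d m \<longleftrightarrow>
    (\<forall>p \<le> total_dim l + 1. admissible l d m p \<longrightarrow> int p - top_degree l d m p \<in> {0, 1})"
proof -
  have "trivial_group (weyman_term TYPE('k) l d m \<nu>) \<longleftrightarrow>
      (\<forall>p \<le> total_dim l + 1. \<not> (admissible l d m p \<and> int p - \<nu> = top_degree l d m p))" for \<nu>
  proof -
    have Sigma_ball: "(\<forall>x\<in>Sigma A B. case x of (p, i) \<Rightarrow> Q p) \<longleftrightarrow> (\<forall>p\<in>A. B p \<noteq> {} \<longrightarrow> Q p)"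
      for A :: "nat set" and B :: "nat \<Rightarrow> nat set" and Q
      by fastforce
    have "trivial_group (weyman_term TYPE('k) l d m \<nu>) \<longleftrightarrow>
      (\<forall>p \<le> total_dim l + 1. trivial_group (cohomology TYPE('k) l (int p - \<nu>) (twist m p d)))"
    proof -
      have "trivial_group (weyman_term TYPE('k) l d m \<nu>) \<longleftrightarrow>
        (\<forall>x\<in>SIGMA p : {0..total_dim l + 1}. {..<(total_dim l + 1) choose p}.
          case x of (p, i) \<Rightarrow> trivial_group (cohomology TYPE('k) l (int p - \<nu>) (twist m p d)))"
        unfolding weyman_term_def trivial_product_group by (simp add: case_prod_unfold)
      then show ?thesis
        unfolding Sigma_ball by (auto simp: lessThan_empty_iff binomial_eq_0_iff)
    qed
    then show ?thesis using nontrivial_cohomology_twist[where 'k = 'k] by blast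
  qed
  then have "determinantal TYPE('k) l d m \<longleftrightarrow>
      (\<forall>p \<le> total_dim l + 1. admissible l d m p \<longrightarrow>
        (\<forall>\<nu>. \<nu> \<notin> {0, 1} \<longrightarrow> \<nu> \<noteq> int p - top_degree l d m p))"
    unfolding determinantal_def by (force simp: algebra_simps)
  then show ?thesis by metis
qed

section \<open>Counting the values of \<open>p\<close> killed by the factors\<close>

text \<open>Dividing by \<open>d\<close> puts \<open>p\<close> into a half-open interval of length
  \<open>l / d\<close>, which holds at most \<open>\<lceil>l / d\<rceil>\<close> integers.\<close>

lemma card_multiples_window_le:
  assumes "d > 0"
  shows "finite {p. m < int p * int d \<and> int p * int d \<le> m + int l}"
    and "int (card {p. m < int p * int d \<and> int p * int d \<le> m + int l}) \<le> \<lceil>real l / real d\<rceil>"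
proof -
  let ?A = "{p. m < int p * int d \<and> int p * int d \<le> m + int l}"
  define lo where "lo = \<lfloor>real_of_int m / real d\<rfloor>"
  define hi where "hi = \<lfloor>(real_of_int m + real l) / real d\<rfloor>"
  have sub: "int ` ?A \<subseteq> {lo<..hi}"
  proof
    fix x assume "x \<in> int ` ?A"
    then have x: "m < x * int d" "x * int d \<le> m + int l" by auto
    then have "real_of_int m < real_of_int x * real d"
      "real_of_int x * real d \<le> real_of_int m + real l"
      by (metis of_int_less_iff of_int_mult of_int_of_nat_eq,
          metis of_int_le_iff of_int_mult of_int_add of_int_of_nat_eq)
    then have "real_of_int m / real d < real_of_int x"
      "real_of_int x \<le> (real_of_int m + real l) / real d"
      using assms by (simp_all add: divide_simps)
    then show "x \<in> {lo<..hi}" by (simp add: lo_def hi_def floor_less_iff le_floor_iff)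
  qed
  then have "finite (int ` ?A)" by (rule finite_subset) simp
  then show "finite ?A" by (simp add: finite_image_iff inj_on_def)
  have "real_of_int hi \<le> real_of_int m / real d + real l / real d"
    unfolding hi_def add_divide_distrib[symmetric] by (rule of_int_floor_le)
  \<comment> \<open>As \<open>m / d < lo + 1\<close> strictly, the integer \<open>hi - lo\<close>
    stays below the ceiling plus one.\<close>
  also have "\<dots> < real_of_int lo + 1 + real_of_int \<lceil>real l / real d\<rceil>"
    unfolding lo_def by linarith
  finally have "hi - lo \<le> \<lceil>real l / real d\<rceil>" by linarith
  moreover have "\<lceil>real l / real d\<rceil> \<ge> 0"
    by (metis ceiling_mono ceiling_zero divide_nonneg_nonneg of_nat_0_le_iff)
  moreover have "card ?A \<le> nat (hi - lo)"
    using card_mono[OF _ sub] by (simp add: card_image)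
  ultimately show "int (card ?A) \<le> \<lceil>real l / real d\<rceil>" by linarith
qed

text \<open>If both are at least 2, then \<open>\<lceil>l k / d k\<rceil> \<le> \<lceil>l k /
  2\<rceil> < l k\<close>.\<close>

lemma defect_zero_cases:
  assumes "l k > 0" "d k > 0" "defect l d k = 0"
  shows "d k = 1 \<or> l k = 1"
proof (rule ccontr)
  assume "\<not> ?thesis"
  then have ge: "l k \<ge> 2" "d k \<ge> 2" using assms by linarith+
  have "real (l k) / real (d k) \<le> real (l k) / 2"
    using ge by (intro divide_left_mono) auto
  then show False using assms ge unfolding defect_def by linarith
qed

lemma defect_nonneg:
  assumes "d k > 0"
  shows "defect l d k \<ge> 0"
proof -
  have "real (l k) / real (d k) \<le> real (l k) / 1"
    using assms by (intro divide_left_mono) auto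
  then show ?thesis unfolding defect_def by linarith
qed

lemma defect_zero_if_two_admissible:
  fixes l d :: "'r::finite \<Rightarrow> nat"
  assumes d: "\<And>k. d k > 0"
    and adm: "\<And>p. p \<le> total_dim l + 1 \<Longrightarrow> admissible l d m p \<Longrightarrow> p \<in> {p0, p1}"
  shows "defect l d k = 0"
proof -
  define bad where "bad = (\<lambda>k. {p. m k < int p * int (d k) \<and> int p * int (d k) \<le> m k + int (l k)})"
  have fin: "finite (bad k)" and card: "int (card (bad k)) \<le> int (l k) - defect l d k" for k
    using card_multiples_window_le[OF d[of k], where m = "m k" and l = "l k"] by (simp_all add: bad_def defect_def)
  have "{..total_dim l + 1} \<subseteq> {p0, p1} \<union> (\<Union>k. bad k)"
  proof
    fix p assume p: "p \<in> {..total_dim l + 1}"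
    show "p \<in> {p0, p1} \<union> (\<Union>k. bad k)"
    proof (cases "admissible l d m p")
      case True
      then show ?thesis using p adm by auto
    next
      case False
      then obtain k where "twist m p d k < 0" "twist m p d k \<ge> - int (l k)"
        unfolding admissible_def by (meson not_le)
      then have "p \<in> bad k" by (simp add: bad_def twist_def)
      then show ?thesis by blast
    qed
  qed
  then have "card {..total_dim l + 1} \<le> card ({p0, p1} \<union> (\<Union>k. bad k))"
    by (intro card_mono) (simp_all add: fin)
  also have "\<dots> \<le> card {p0, p1} + card (\<Union>k. bad k)" by (rule card_Un_le)
  also have "\<dots> \<le> 2 + (\<Sum>k\<in>UNIV. card (bad k))"
    by (intro add_mono card_UN_le) (simp_all add: card_insert_if)
  \<comment> \<open>Of the \<open>total_dim l + 2\<close> values of \<open>p\<close>, two are set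
    aside.\<close>
  finally have "int (total_dim l) \<le> (\<Sum>k\<in>UNIV. int (card (bad k)))"
    by (simp flip: of_nat_sum)
  also have "\<dots> \<le> (\<Sum>k\<in>UNIV. int (l k) - defect l d k)" by (intro sum_mono card)
  also have "\<dots> = int (total_dim l) - (\<Sum>k\<in>UNIV. defect l d k)"
    by (simp add: sum_subtractf total_dim_def)
  finally have "(\<Sum>k\<in>UNIV. defect l d k) = 0"
    using sum_nonneg[of UNIV "defect l d"] defect_nonneg[of d _ l] d by simp
  then show ?thesis
    using sum_nonneg_eq_0_iff[of UNIV "defect l d"] defect_nonneg[of d _ l] d by simp
qed

section \<open>Construction of a vector from consecutive blocks\<close>

text \<open>Partial sums of \<open>l\<close>, with the factors ordered by an injection into the
  naturals, cut \<open>{1..total_dim l}\<close> into blocks ending at \<open>P k\<close>. The form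
  \<open>P k < p + l k\<close> avoids truncated subtraction.\<close>

lemma consecutive_blocks:
  fixes l :: "'r::finite \<Rightarrow> nat"
  shows "\<exists>P. (\<forall>k. l k \<le> P k \<and> P k \<le> total_dim l) \<and>
    (\<forall>p. 0 < p \<longrightarrow> p \<le> total_dim l \<longrightarrow> (\<exists>k. P k < p + l k \<and> p \<le> P k))"
proof -
  obtain idx :: "'r \<Rightarrow> nat" where idx: "inj idx"
    using finite_imp_inj_to_nat_seg[of "UNIV :: 'r set"] by auto
  define P where "P = (\<lambda>k. \<Sum>j | idx j \<le> idx k. l j)"
  have split: "P k = l k + (\<Sum>j | idx j < idx k. l j)" for k
  proof -
    have "{j. idx j \<le> idx k} = insert k {j. idx j < idx k}"
      using idx by (auto simp: le_less dest: injD)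
    then show ?thesis by (simp add: P_def)
  qed
  have last: "\<exists>j0\<in>L. \<forall>j\<in>L. idx j \<le> idx j0" if "L \<noteq> {}" for L :: "'r set"
    using that Max_in[of "idx ` L"] Max_ge[of "idx ` L"] by fastforce
  show ?thesis
  proof (intro exI[of _ P] conjI allI impI)
    show "l k \<le> P k" for k by (simp add: split)
    show "P k \<le> total_dim l" for k
      unfolding P_def total_dim_def by (intro sum_mono2) auto
    fix p assume p: "0 < p" "p \<le> total_dim l"
    obtain j0 where "\<forall>j. idx j \<le> idx j0" using last[of UNIV] by auto
    then have "p \<le> P j0" using p by (simp add: P_def total_dim_def)
    \<comment> \<open>The first factor whose partial sum reaches \<open>p\<close> owns the block of
      \<open>p\<close>.\<close>
    then obtain k where k: "p \<le> P k" "\<And>j. p \<le> P j \<Longrightarrow> idx k \<le> idx j"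
      using ex_has_least_nat[of "\<lambda>j. p \<le> P j" j0 idx] by blast
    have "(\<Sum>j | idx j < idx k. l j) < p"
    proof (cases "{j. idx j < idx k} = {}")
      case True
      then show ?thesis using p by simp
    next
      case False
      \<comment> \<open>The factor \<open>j1\<close> directly precedes \<open>k\<close>, so its
        partial sum is where the block of \<open>k\<close> starts; minimality puts it below
        \<open>p\<close>.\<close>
      then obtain j1 where j1: "idx j1 < idx k" "\<And>j. idx j < idx k \<Longrightarrow> idx j \<le> idx j1"
        using last[OF False] by auto
      have "{j. idx j < idx k} = {j. idx j \<le> idx j1}"
        using j1 by force
      then have "(\<Sum>j | idx j < idx k. l j) = P j1" by (simp add: P_def)
      moreover have "P j1 < p" using k(2)[of j1] j1(1) by linarith
      ultimately show ?thesis by simp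
    qed
    then show "\<exists>k. P k < p + l k \<and> p \<le> P k"
      using k(1) split[of k] by (intro exI[of _ k]) simp
  qed
qed

text \<open>Factor \<open>k\<close> kills \<open>p\<close> iff
  \<open>0 \<le> (P k - p) * d k < l k\<close>. As \<open>d k = 1\<close> or \<open>l k = 1\<close>,
  these \<open>p\<close> form the whole block ending at \<open>P k\<close>; together the blocks
  leave just the two ends, where all twists are nonnegative or all lie below
  \<open>- l k\<close>.\<close>

lemma two_admissible_if_defect_zero:
  fixes l d :: "'r::finite \<Rightarrow> nat"
  assumes l: "\<And>k. l k > 0" and d: "\<And>k. d k > 0" and defect: "\<And>k. defect l d k = 0"
  obtains m where "\<And>p. p \<le> total_dim l + 1 \<Longrightarrow> admissible l d m p \<longleftrightarrow> p = 0 \<or> p = total_dim l + 1"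
    "top_degree l d m 0 = 0" "top_degree l d m (total_dim l + 1) = int (total_dim l)"
proof -
  obtain P where P: "\<And>k. l k \<le> P k" "\<And>k. P k \<le> total_dim l"
    "\<And>p. 0 < p \<Longrightarrow> p \<le> total_dim l \<Longrightarrow> \<exists>k. P k < p + l k \<and> p \<le> P k"
    using consecutive_blocks[of l] by auto
  define m where "m = (\<lambda>k. int (P k) * int (d k) - int (l k))"
  have twist: "twist m p d k = (int (P k) - int p) * int (d k) - int (l k)" for p k
    by (simp add: twist_def m_def algebra_simps)
  have first: "twist m 0 d k \<ge> 0" for k
  proof -
    have "int (l k) * 1 \<le> int (P k) * int (d k)"
      using P(1)[of k] d[of k] by (intro mult_mono) auto
    then show ?thesis by (simp add: twist)
  qed
  have final: "twist m (total_dim l + 1) d k < - int (l k)" for k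
  proof -
    have "(int (P k) - int (total_dim l + 1)) * int (d k) < 0"
      using P(2)[of k] d[of k] by (intro mult_neg_pos) auto
    then show ?thesis by (simp add: twist)
  qed
  show ?thesis
  proof
    show "top_degree l d m 0 = 0"
      unfolding top_degree_def
    proof (intro sum.neutral ballI)
      show "(if twist m 0 d k < - int (l k) then int (l k) else 0) = 0" for k
        using first[of k] by simp
    qed
    show "top_degree l d m (total_dim l + 1) = int (total_dim l)"
      unfolding top_degree_def using final by (simp add: total_dim_def)
    fix p assume p: "p \<le> total_dim l + 1"
    show "admissible l d m p \<longleftrightarrow> p = 0 \<or> p = total_dim l + 1"
    proof
      assume "p = 0 \<or> p = total_dim l + 1"
      then show "admissible l d m p" using first final by (auto simp: admissible_def)
    next
      assume adm: "admissible l d m p"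
      show "p = 0 \<or> p = total_dim l + 1"
      proof (rule ccontr)
        assume "\<not> ?thesis"
        then obtain k where k: "P k < p + l k" "p \<le> P k" using P(3)[of p] p by force
        consider "d k = 1" | "l k = 1" using defect_zero_cases[of l k d, OF l d defect] by blast
        then have "twist m p d k < 0 \<and> twist m p d k \<ge> - int (l k)"
        proof cases
          case 1
          then show ?thesis using k by (auto simp: twist)
        next
          case 2
          then have "P k = p" using k by simp
          then show ?thesis using 2 by (simp add: twist)
        qed
        then show False using adm unfolding admissible_def by (meson not_le)
      qed
    qed
  qed
qed

theorem theorem4p5:
  fixes l d :: "'r::finite \<Rightarrow> nat"
  assumes "\<And>k. l k > 0" and "\<And>k. d k > 0"
  shows "(\<exists>m :: 'r \<Rightarrow> int.
            determinantal TYPE('k::{alg_closed_field, field_char_0}) l d m \<and>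
            (\<forall>\<nu>\<in>{0, 1}. \<exists>!p. p \<in> {0..total_dim l + 1} \<and>
               \<not> trivial_group (cohomology TYPE('k) l (int p - \<nu>) (twist m p d))))
         \<longleftrightarrow> (\<forall>k. defect l d k = 0)"
  unfolding determinantal_iff nontrivial_cohomology_twist
proof
  assume "\<exists>m. (\<forall>p \<le> total_dim l + 1. admissible l d m p \<longrightarrow> int p - top_degree l d m p \<in> {0, 1}) \<and>
    (\<forall>\<nu>\<in>{0, 1}. \<exists>!p. p \<in> {0..total_dim l + 1} \<and> admissible l d m p \<and> int p - \<nu> = top_degree l d m p)"
  then obtain m where
    det: "\<forall>p \<le> total_dim l + 1. admissible l d m p \<longrightarrow> int p - top_degree l d m p \<in> {0, 1}" and
    ex1: "\<forall>\<nu>\<in>{0, 1}.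
      \<exists>!p. p \<in> {0..total_dim l + 1} \<and> admissible l d m p \<and> int p - \<nu> = top_degree l d m p"
    by (elim exE conjE)
  obtain p0 where p0: "\<And>p. p \<le> total_dim l + 1 \<Longrightarrow> admissible l d m p \<Longrightarrow>
      int p - 0 = top_degree l d m p \<Longrightarrow> p = p0"
    using bspec[OF ex1, of 0] by (auto simp: Ex1_def)
  obtain p1 where p1: "\<And>p. p \<le> total_dim l + 1 \<Longrightarrow> admissible l d m p \<Longrightarrow>
      int p - 1 = top_degree l d m p \<Longrightarrow> p = p1"
    using bspec[OF ex1, of 1] by (auto simp: Ex1_def)
  \<comment> \<open>By \<open>det\<close>, \<open>p\<close> belongs to the term of index 0 or 1, and
    each of them admits one value only.\<close>
  have "p \<in> {p0, p1}" if "p \<le> total_dim l + 1" "admissible l d m p" for p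
    using det that p0[OF that] p1[OF that] by auto
  then show "\<forall>k. defect l d k = 0"
    using defect_zero_if_two_admissible[of d l m p0 p1] assms(2) by blast
next
  assume "\<forall>k. defect l d k = 0"
  then obtain m where m:
    "\<And>p. p \<le> total_dim l + 1 \<Longrightarrow> admissible l d m p \<longleftrightarrow> p = 0 \<or> p = total_dim l + 1"
    "top_degree l d m 0 = 0" "top_degree l d m (total_dim l + 1) = int (total_dim l)"
    using two_admissible_if_defect_zero[of l d] assms by blast
  \<comment> \<open>The value 0 has degree 0 and lands in the term of index 0;
    \<open>total_dim l + 1\<close> has degree \<open>total_dim l\<close> and lands in the term of
    index 1.\<close>
  have "\<exists>!p. p \<in> {0..total_dim l + 1} \<and> admissible l d m p \<and> int p - 0 = top_degree l d m p"
    using m by (intro ex1I[of _ 0]) auto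
  moreover have "\<exists>!p. p \<in> {0..total_dim l + 1} \<and> admissible l d m p \<and> int p - 1 = top_degree l d m p"
    using m by (intro ex1I[of _ "total_dim l + 1"]) auto
  ultimately show "\<exists>m. (\<forall>p \<le> total_dim l + 1. admissible l d m p \<longrightarrow> int p - top_degree l d m p \<in> {0, 1}) \<and>
    (\<forall>\<nu>\<in>{0, 1}. \<exists>!p. p \<in> {0..total_dim l + 1} \<and> admissible l d m p \<and> int p - \<nu> = top_degree l d m p)"
    using m by (intro exI[of _ m]) auto
qed

end
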